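(* Let $(X,d)$ be a complete metric space, let $\delta\colon X\times X\to[0,\infty)$ be a semimetric, and let $T\colon X\to X$ be a multiplicative-type contraction with respect to $\delta$, i.e. there exists $\alpha\in[0,1)$ such that $$d(Tx,Ty)\,\delta(Tx,Ty)\le \alpha\, d(x,y)\,\delta(x,y)\quad\text{for all }x,y\in X.$$ If $\delta$ is both $d$-regular and $d$-lower bounded, then $T$ is a Picard operator on $(X,d)$.
   Context: $X$ is a nonempty set. A semimetric on $X$ is a map $\delta\colon X\times X\to[0,\infty)$ such that $\delta(x,y)=0$ if and only if $x=y$, and $\delta(x,y)=\delta(y,x)$ for all $x,y\in X$ (no triangle inequality is required). The semimetric $\delta$ is $d$-regular if for every $x^*\in X$ and every sequence $(x_n)$ in $X$ with $d(x_n,x^* )\to0$ we have $d(x_n,x^* )\delta(x_n,x^* )\to0$. The semimetric $\delta$ is $d$-lower bounded if there exist constants $c>0$ and $\gamma>0$ such that $\delta(x,y)\ge c\,d(x,y)^\gamma$ for all $x,y\in X$. A self-mapping $T$ of a metric space $(X,d)$ is called a Picard operator if $T$ has a unique fixed point $u\in X$ and for every $x\in X$ the sequence of iterates $(T^n x)$ converges to $u$ in $(X,d)$. *)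

theory Defs
  imports "HOL-Analysis.Analysis"
begin

text \<open>
  Metric spaces are carrier-based (the library locale \<^locale>\<open>Metric_space\<close>), so every
  notion below is relativised to the carrier \<open>X\<close>; the values of \<open>\<delta>\<close> and \<open>T\<close> outside \<open>X\<close> are irrelevant.
  In the lower bound, \<open>0 powr \<gamma> = 0\<close>, so the diagonal imposes no condition.
\<close>

definition semimetric_on :: "'a set \<Rightarrow> ('a \<Rightarrow> 'a \<Rightarrow> real) \<Rightarrow> bool" where
  "semimetric_on X \<delta> \<longleftrightarrow>
     (\<forall>x\<in>X. \<forall>y\<in>X. 0 \<le> \<delta> x y \<and> (\<delta> x y = 0 \<longleftrightarrow> x = y) \<and> \<delta> x y = \<delta> y x)"

definition d_regular :: "'a set \<Rightarrow> ('a \<Rightarrow> 'a \<Rightarrow> real) \<Rightarrow> ('a \<Rightarrow> 'a \<Rightarrow> real) \<Rightarrow> bool" where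
  "d_regular X d \<delta> \<longleftrightarrow>
     (\<forall>z\<in>X. \<forall>x :: nat \<Rightarrow> 'a. range x \<subseteq> X \<longrightarrow>
        (\<lambda>n. d (x n) z) \<longlonglongrightarrow> 0 \<longrightarrow> (\<lambda>n. d (x n) z * \<delta> (x n) z) \<longlonglongrightarrow> 0)"

definition d_lower_bounded :: "'a set \<Rightarrow> ('a \<Rightarrow> 'a \<Rightarrow> real) \<Rightarrow> ('a \<Rightarrow> 'a \<Rightarrow> real) \<Rightarrow> bool" where
  "d_lower_bounded X d \<delta> \<longleftrightarrow>
     (\<exists>c>0. \<exists>\<gamma>>0. \<forall>x\<in>X. \<forall>y\<in>X. \<delta> x y \<ge> c * d x y powr \<gamma>)"

definition multiplicative_contraction ::
  "'a set \<Rightarrow> ('a \<Rightarrow> 'a \<Rightarrow> real) \<Rightarrow> ('a \<Rightarrow> 'a \<Rightarrow> real) \<Rightarrow> ('a \<Rightarrow> 'a) \<Rightarrow> bool" where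
  "multiplicative_contraction X d \<delta> T \<longleftrightarrow>
     (\<exists>\<alpha>. 0 \<le> \<alpha> \<and> \<alpha> < 1 \<and>
        (\<forall>x\<in>X. \<forall>y\<in>X. d (T x) (T y) * \<delta> (T x) (T y) \<le> \<alpha> * (d x y * \<delta> x y)))"

definition Picard_operator :: "'a set \<Rightarrow> ('a \<Rightarrow> 'a \<Rightarrow> real) \<Rightarrow> ('a \<Rightarrow> 'a) \<Rightarrow> bool" where
  "Picard_operator X d T \<longleftrightarrow>
     T \<in> X \<rightarrow> X \<and>
     (\<exists>u\<in>X. T u = u \<and> (\<forall>v\<in>X. T v = v \<longrightarrow> v = u) \<and>
        (\<forall>x\<in>X. limitin (Metric_space.mtopology X d) (\<lambda>n. (T ^^ n) x) u sequentially))"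

end

theory Submission
  imports Defs
begin

text \<open>
  The product \<open>p x y = d x y * \<delta> x y\<close> decays like \<open>\<alpha> ^ n\<close> along pairs of orbits, and the lower bound
  \<open>c * d x y powr (1 + \<gamma>) \<le> p x y\<close> turns this into geometric decay of \<open>d\<close> itself. Hence every
  orbit is Cauchy and all orbits are asymptotic to each other. Regularity makes \<open>p x\<^sub>n u\<close>, hence
  \<open>p (T x\<^sub>n) (T u)\<close>, hence \<open>d (T x\<^sub>n) (T u)\<close> tend to \<open>0\<close> when \<open>x\<^sub>n\<close> tends to \<open>u\<close>, so \<open>T\<close> is continuous
  and the common limit of the orbits is its unique fixed point.
\<close>

text \<open>By the triangle inequality, the distance between two terms is at most the sum of the
  step bounds \<open>f\<close> between them, and the Cauchy criterion for series makes these blocks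
  small.\<close>

lemma (in Metric_space) MCauchy_if_summable_dist:
  assumes "range \<sigma> \<subseteq> M" and "summable f" and step: "\<And>n. d (\<sigma> n) (\<sigma> (Suc n)) \<le> f n"
  shows "MCauchy \<sigma>"
  unfolding MCauchy_def
proof (intro conjI strip)
  fix \<epsilon> :: real
  assume "\<epsilon> > 0"
  then obtain N where N: "\<And>m n. N \<le> m \<Longrightarrow> norm (sum f {m..<n}) < \<epsilon>"
    using \<open>summable f\<close> by (meson summable_Cauchy)
  have \<sigma>: "\<sigma> n \<in> M" for n
    using assms by auto
  have bound: "d (\<sigma> m) (\<sigma> n) \<le> sum f {m..<n}" if "m \<le> n" for m n
    using that
  proof (induction n rule: dec_induct)
    case base
    then show ?case
      using \<sigma> by simp
  next
    case (step n)
    have "d (\<sigma> m) (\<sigma> (Suc n)) \<le> d (\<sigma> m) (\<sigma> n) + d (\<sigma> n) (\<sigma> (Suc n))"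
      using \<sigma> triangle by blast
    then show ?case
      using step assms(3)[of n] by simp
  qed
  have less: "d (\<sigma> m) (\<sigma> n) < \<epsilon>" if "N \<le> m" "m \<le> n" for m n
    using bound[of m n] N[of m n] that by simp
  have "d (\<sigma> m) (\<sigma> n) < \<epsilon>" if "N \<le> m" "N \<le> n" for m n
    using less[of m n] less[of n m] that commute[of "\<sigma> m" "\<sigma> n"] by (cases "m \<le> n") auto
  then show "\<exists>N. \<forall>n n'. N \<le> n \<longrightarrow> N \<le> n' \<longrightarrow> d (\<sigma> n) (\<sigma> n') < \<epsilon>"
    by blast
qed (use assms in auto)

lemma funpow_closed:
  assumes "T \<in> X \<rightarrow> X" "x \<in> X"
  shows "(T ^^ n) x \<in> X"
  using assms by (induction n) auto

text \<open>The constant is chosen positive so that powers of it can be computed with \<^const>\<open>powr\<close>.\<close>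

lemma multiplicative_contraction_pos:
  assumes "multiplicative_contraction X d \<delta> T" "Metric_space X d" "semimetric_on X \<delta>"
  obtains \<alpha> where "0 < \<alpha>" "\<alpha> < 1"
    "\<And>x y. \<lbrakk>x \<in> X; y \<in> X\<rbrakk> \<Longrightarrow> d (T x) (T y) * \<delta> (T x) (T y) \<le> \<alpha> * (d x y * \<delta> x y)"
proof -
  obtain a where a: "0 \<le> a" "a < 1"
    "\<And>x y. \<lbrakk>x \<in> X; y \<in> X\<rbrakk> \<Longrightarrow> d (T x) (T y) * \<delta> (T x) (T y) \<le> a * (d x y * \<delta> x y)"
    using assms(1) unfolding multiplicative_contraction_def by blast
  have "0 \<le> d x y * \<delta> x y" if "x \<in> X" "y \<in> X" for x y
    using that assms(3) Metric_space.nonneg[OF assms(2)] by (simp add: semimetric_on_def)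
  \<comment> \<open>Since the product is nonnegative, the constant may be enlarged; 1/2 is an
    arbitrary choice strictly between 0 and 1.\<close>
  then have "a * (d x y * \<delta> x y) \<le> max a (1/2) * (d x y * \<delta> x y)" if "x \<in> X" "y \<in> X" for x y
    using that by (intro mult_right_mono) auto
  then have "d (T x) (T y) * \<delta> (T x) (T y) \<le> max a (1/2) * (d x y * \<delta> x y)"
    if "x \<in> X" "y \<in> X" for x y
    using a(3) that by (meson order_trans)
  then show thesis
    using a by (intro that[of "max a (1/2)"]) auto
qed

lemma funpow_product_le:
  fixes d \<delta> :: "'a \<Rightarrow> 'a \<Rightarrow> real"
  assumes "T \<in> X \<rightarrow> X" "0 \<le> \<alpha>" "x \<in> X" "y \<in> X"
    and contr: "\<And>x y. \<lbrakk>x \<in> X; y \<in> X\<rbrakk> \<Longrightarrow> d (T x) (T y) * \<delta> (T x) (T y) \<le> \<alpha> * (d x y * \<delta> x y)"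
  shows "d ((T ^^ n) x) ((T ^^ n) y) * \<delta> ((T ^^ n) x) ((T ^^ n) y) \<le> \<alpha> ^ n * (d x y * \<delta> x y)"
proof (induction n)
  case (Suc n)
  have "d ((T ^^ Suc n) x) ((T ^^ Suc n) y) * \<delta> ((T ^^ Suc n) x) ((T ^^ Suc n) y)
      \<le> \<alpha> * (d ((T ^^ n) x) ((T ^^ n) y) * \<delta> ((T ^^ n) x) ((T ^^ n) y))"
    using contr funpow_closed[OF assms(1)] assms(3,4) by simp
  also have "\<dots> \<le> \<alpha> * (\<alpha> ^ n * (d x y * \<delta> x y))"
    using Suc \<open>0 \<le> \<alpha>\<close> by (rule mult_left_mono)
  finally show ?case
    by (simp add: mult.assoc)
qed simp

text \<open>Multiplying the lower bound by \<open>d x y\<close> raises its exponent to 1 + \<gamma>;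
  extracting that root gives \<open>s\<close> = 1 / (1 + \<gamma>).\<close>

lemma d_lower_bounded_powr_bound:
  assumes "d_lower_bounded X d \<delta>" "Metric_space X d"
  obtains c s where "0 < c" "0 < s"
    "\<And>x y. \<lbrakk>x \<in> X; y \<in> X\<rbrakk> \<Longrightarrow> d x y \<le> (d x y * \<delta> x y / c) powr s"
proof -
  obtain c \<gamma> where c: "0 < c" "0 < \<gamma>" "\<And>x y. \<lbrakk>x \<in> X; y \<in> X\<rbrakk> \<Longrightarrow> \<delta> x y \<ge> c * d x y powr \<gamma>"
    using assms(1) unfolding d_lower_bounded_def by blast
  have "d x y \<le> (d x y * \<delta> x y / c) powr (1 / (1 + \<gamma>))" if "x \<in> X" "y \<in> X" for x y
  proof -
    have nonneg: "0 \<le> d x y"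
      using Metric_space.nonneg[OF assms(2)] .
    have "d x y powr (1 + \<gamma>) = d x y * d x y powr \<gamma>"
      using nonneg by (simp add: powr_add)
    also have "\<dots> \<le> d x y * \<delta> x y / c"
      using mult_left_mono[OF c(3)[OF that] nonneg] \<open>0 < c\<close> by (simp add: field_simps)
    finally have "(d x y powr (1 + \<gamma>)) powr (1 / (1 + \<gamma>)) \<le> (d x y * \<delta> x y / c) powr (1 / (1 + \<gamma>))"
      using \<open>0 < \<gamma>\<close> by (intro powr_mono2) auto
    then show ?thesis
      using nonneg \<open>0 < \<gamma>\<close> by (simp add: powr_powr)
  qed
  with c that[of c "1 / (1 + \<gamma>)"] show thesis
    by simp
qed

theorem theorem4p5:
  fixes X :: "'a set" and d \<delta> :: "'a \<Rightarrow> 'a \<Rightarrow> real" and T :: "'a \<Rightarrow> 'a"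
  assumes "X \<noteq> {}"
    and "Metric_space X d"
    and "Metric_space.mcomplete X d"
    and "semimetric_on X \<delta>"
    and "T \<in> X \<rightarrow> X"
    and "multiplicative_contraction X d \<delta> T"
    and "d_regular X d \<delta>"
    and "d_lower_bounded X d \<delta>"
  shows "Picard_operator X d T"
proof -
  interpret Metric_space X d
    by fact
  define p where "p x y = d x y * \<delta> x y" for x y
  note T_funpow = funpow_closed[OF \<open>T \<in> X \<rightarrow> X\<close>]
  have p_nonneg: "0 \<le> p x y" if "x \<in> X" "y \<in> X" for x y
    using that \<open>semimetric_on X \<delta>\<close> by (simp add: p_def semimetric_on_def)
  obtain \<alpha> where \<alpha>: "0 < \<alpha>" "\<alpha> < 1"
    and contr: "\<And>x y. \<lbrakk>x \<in> X; y \<in> X\<rbrakk> \<Longrightarrow> p (T x) (T y) \<le> \<alpha> * p x y"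
    unfolding p_def using multiplicative_contraction_pos[OF assms(6,2,4)] by metis
  obtain c s where cs: "0 < c" "0 < s"
    and bound: "\<And>x y. \<lbrakk>x \<in> X; y \<in> X\<rbrakk> \<Longrightarrow> d x y \<le> (p x y / c) powr s"
    unfolding p_def using d_lower_bounded_powr_bound[OF assms(8,2)] by metis
  \<comment> \<open>The root turns the rate \<alpha> of the product into the rate \<beta> of the
    distance: \<open>(\<alpha> ^ n) powr s = \<beta> ^ n\<close>.\<close>
  define \<beta> where "\<beta> = \<alpha> powr s"
  have \<beta>: "0 < \<beta>" "\<beta> < 1"
    unfolding \<beta>_def using \<alpha> cs powr_less_mono2[of s \<alpha> 1] by auto
  have decay: "d ((T ^^ n) x) ((T ^^ n) y) \<le> (p x y / c) powr s * \<beta> ^ n"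
    if "x \<in> X" "y \<in> X" for x y n
  proof -
    have "p ((T ^^ n) x) ((T ^^ n) y) \<le> \<alpha> ^ n * p x y"
      using funpow_product_le[OF \<open>T \<in> X \<rightarrow> X\<close> _ that, of \<alpha> d \<delta>] \<alpha> contr
      by (simp add: p_def)
    then have "p ((T ^^ n) x) ((T ^^ n) y) / c \<le> p x y / c * \<alpha> ^ n"
      using cs by (simp add: field_simps)
    then have "(p ((T ^^ n) x) ((T ^^ n) y) / c) powr s \<le> (p x y / c * \<alpha> ^ n) powr s"
      using cs that T_funpow p_nonneg by (intro powr_mono2) auto
    also have "\<dots> = (p x y / c) powr s * (\<alpha> ^ n) powr s"
      by (rule powr_mult)
    also have "(\<alpha> ^ n) powr s = \<beta> ^ n"
      using \<alpha> \<beta> by (metis \<beta>_def powr_powr_swap powr_realpow)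
    finally show ?thesis
      using bound[of "(T ^^ n) x" "(T ^^ n) y"] that T_funpow by fastforce
  qed
  have asymptotic: "(\<lambda>n. d ((T ^^ n) x) ((T ^^ n) y)) \<longlonglongrightarrow> 0" if "x \<in> X" "y \<in> X" for x y
  proof (rule tendsto_sandwich[OF _ _ tendsto_const])
    show "(\<lambda>n. (p x y / c) powr s * \<beta> ^ n) \<longlonglongrightarrow> 0"
      using \<beta> by (intro tendsto_mult_right_zero LIMSEQ_realpow_zero) auto
  qed (use decay[OF that] in auto)
  obtain x0 where x0: "x0 \<in> X"
    using \<open>X \<noteq> {}\<close> by blast
  have "MCauchy (\<lambda>n. (T ^^ n) x0)"
  proof (rule MCauchy_if_summable_dist)
    show "summable (\<lambda>n. (p x0 (T x0) / c) powr s * \<beta> ^ n)"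
      using \<beta> by (intro summable_mult summable_geometric) auto
    \<comment> \<open>Consecutive iterates are the n-th iterates of \<open>x0\<close> and
      \<open>T x0\<close>, so \<open>decay\<close> applies to this pair of starting points.\<close>
    show "d ((T ^^ n) x0) ((T ^^ Suc n) x0) \<le> (p x0 (T x0) / c) powr s * \<beta> ^ n" for n
      using decay[of x0 "T x0" n] x0 \<open>T \<in> X \<rightarrow> X\<close> by (auto simp: funpow_swap1)
  qed (use x0 T_funpow in auto)
  then obtain u where "limitin mtopology (\<lambda>n. (T ^^ n) x0) u sequentially"
    using \<open>mcomplete\<close> unfolding mcomplete_def by blast
  then have u: "u \<in> X" and lim: "(\<lambda>n. d ((T ^^ n) x0) u) \<longlonglongrightarrow> 0"
    by (auto simp: limitin_metric_dist_null)
  have Tu: "T u \<in> X"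
    using u \<open>T \<in> X \<rightarrow> X\<close> by auto
  \<comment> \<open>Continuity of \<open>T\<close> at \<open>u\<close> is established along this
    orbit only. Convergence of the distance alone would not suffice, because \<delta> need not stay
    bounded near \<open>u\<close>; regularity controls the product.\<close>
  have "(\<lambda>n. p ((T ^^ n) x0) u) \<longlonglongrightarrow> 0"
    using \<open>d_regular X d \<delta>\<close> u lim T_funpow[OF x0]
    unfolding d_regular_def p_def by (simp add: image_subset_iff)
  \<comment> \<open>The base tends to 0, so continuity of \<open>powr\<close> in the base rests on
    \<open>s\<close> > 0 and on the base being nonnegative; the limit is \<open>0 powr s\<close> =
    0.\<close>
  then have "(\<lambda>n. (\<alpha> * p ((T ^^ n) x0) u / c) powr s) \<longlonglongrightarrow> (\<alpha> * 0 / c) powr s"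
    using \<open>0 < s\<close> \<open>0 < c\<close> \<alpha> p_nonneg T_funpow[OF x0] u
    by (intro tendsto_powr' tendsto_intros) auto
  moreover have "d ((T ^^ Suc n) x0) (T u) \<le> (\<alpha> * p ((T ^^ n) x0) u / c) powr s" for n
  proof -
    have "d ((T ^^ Suc n) x0) (T u) \<le> (p ((T ^^ Suc n) x0) (T u) / c) powr s"
      using bound T_funpow[OF x0] Tu by blast
    also have "\<dots> \<le> (\<alpha> * p ((T ^^ n) x0) u / c) powr s"
      using contr[OF T_funpow[OF x0] u] p_nonneg[OF T_funpow[OF x0, of "Suc n"] Tu] cs
      by (intro powr_mono2 divide_right_mono) auto
    finally show ?thesis .
  qed
  ultimately have "(\<lambda>n. d ((T ^^ Suc n) x0) (T u)) \<longlonglongrightarrow> 0"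
    by - (rule tendsto_sandwich[OF _ _ tendsto_const], auto)
  then have "(\<lambda>n. d ((T ^^ n) x0) (T u)) \<longlonglongrightarrow> 0"
    by (rule LIMSEQ_imp_Suc)
  \<comment> \<open>The same orbit converges to both \<open>u\<close> and \<open>T u\<close>, and
    limits are unique.\<close>
  then have fixed: "T u = u"
    using limitin_metric_unique[of "\<lambda>n. (T ^^ n) x0" "T u" sequentially u] lim u Tu T_funpow[OF x0]
    by (simp add: limitin_metric_dist_null)
  have fixed_funpow: "(T ^^ n) v = v" if "T v = v" for n v
    using that by (induction n) auto
  \<comment> \<open>Both orbits are constant, so the null sequence of their distances is the
    constant \<open>d v u\<close>.\<close>
  have "v = u" if "v \<in> X" "T v = v" for v
    using asymptotic[OF that(1) u] that u by (simp add: fixed fixed_funpow LIMSEQ_const_iff)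
  moreover have "limitin mtopology (\<lambda>n. (T ^^ n) x) u sequentially" if "x \<in> X" for x
    using asymptotic[OF that u] u T_funpow[OF that]
    by (simp add: fixed fixed_funpow limitin_metric_dist_null)
  ultimately show ?thesis
    unfolding Picard_operator_def using \<open>T \<in> X \<rightarrow> X\<close> u fixed by blast
qed

end
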